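(* Let $k$ and $\ell$ be positive integers with $k \equiv 1$ or $3 \pmod 6$ and $\ell \equiv 1$ or $3 \pmod 6$, and let $n = k\cdot \ell$. Then there exists a mixed Steiner triple system $\mathrm{MS}(2,3,\mathbb{Z}_2^n \times \mathbb{Z}_{k+1}\times \mathbb{Z}_{\ell+1})$.
   Context: $\mathbb{Z}_q=\{0,1,\ldots,q-1\}$. For a mixed alphabet $Q=\mathbb{Z}_{q_1}\times\cdots\times\mathbb{Z}_{q_N}$ with all $q_i\ge 2$, the weight of a word in $Q$ is its number of nonzero coordinates, and $d(x,y)$ is the Hamming distance (the number of coordinates in which $x$ and $y$ differ). A mixed Steiner triple system $\mathrm{MS}(2,3,Q)$ is a set $\mathcal{C}\subseteq Q$ of words (codewords) of weight $3$ such that (i) for each word $x\in Q$ of weight $2$ there is exactly one $c\in\mathcal{C}$ that covers $x$, i.e. $d(x,c)=1$; and (ii) the minimum Hamming distance of $\mathcal{C}$ is $3$, meaning $d(c,c')\ge 3$ for all distinct $c,c'\in\mathcal{C}$. *)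

theory Defs imports Main begin

text \<open>
  A mixed alphabet \<open>\<int>\<^bsub>q\<^sub>1\<^esub> \<times> \<dots> \<times> \<int>\<^bsub>q\<^sub>N\<^esub>\<close> is given by the list
  \<open>[q\<^sub>1, \<dots>, q\<^sub>N]\<close> of its alphabet sizes; coordinates are numbered from 0.
\<close>

definition mixed_words :: "nat list \<Rightarrow> nat list set" where
  "mixed_words qs = {x. length x = length qs \<and> (\<forall>i<length qs. x ! i < qs ! i)}"

definition weight :: "nat list \<Rightarrow> nat" where
  "weight x = card {i. i < length x \<and> x ! i \<noteq> 0}"

text \<open>Only meaningful for words of equal length.\<close>

definition hamming_dist :: "nat list \<Rightarrow> nat list \<Rightarrow> nat" where
  "hamming_dist x y = card {i. i < length x \<and> x ! i \<noteq> y ! i}"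

definition covers :: "nat list \<Rightarrow> nat list \<Rightarrow> bool" where
  "covers c x \<longleftrightarrow> hamming_dist x c = 1"

text \<open>
  The minimum distance requirement is the inequality for all pairs of distinct codewords,
  so it holds vacuously for a code with a single codeword.
\<close>

definition mixed_steiner_triple_system :: "nat list \<Rightarrow> nat list set \<Rightarrow> bool" where
  "mixed_steiner_triple_system qs C \<longleftrightarrow>
     (\<forall>q\<in>set qs. 2 \<le> q) \<and>
     C \<subseteq> mixed_words qs \<and>
     (\<forall>c\<in>C. weight c = 3) \<and>
     (\<forall>x\<in>mixed_words qs. weight x = 2 \<longrightarrow> (\<exists>!c. c \<in> C \<and> covers c x)) \<and>
     (\<forall>c\<in>C. \<forall>c'\<in>C. c \<noteq> c' \<longrightarrow> 3 \<le> hamming_dist c c')"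

end

theory Submission imports Defs begin

text \<open>
  Adjoining a zero to a Steiner triple system on \<open>k\<close> points gives a Steiner loop on
  \<open>{0, \<dots>, k}\<close>, in which \<open>u + v\<close> is the third point of the block through \<open>u\<close> and \<open>v\<close>.
  The product of two such loops, of orders \<open>k + 1\<close> and \<open>l + 1\<close>, is again a Steiner loop. Its nonzero
  elements correspond to the pairs (coordinate, nonzero symbol): \<open>(a, 0)\<close> and \<open>(0, b)\<close>
  are symbols of the two large coordinates, and each \<open>(a, b)\<close> with both entries nonzero is a
  binary coordinate of its own. The codewords are the triples \<open>{u, v, u + v}\<close> that meet three
  different coordinates. The Steiner triple systems themselves come from the constructions of Bose
  (\<open>6t + 3\<close> points) and Skolem (\<open>6t + 1\<close> points).
\<close>

section \<open>Codes from a partial Steiner loop\<close>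

text \<open>The assumptions make \<open>p\<close> to \<open>(crd p, sym p)\<close> a bijection from
  \<open>P\<close> onto the pairs of a coordinate and a nonzero symbol there, so words can be
  handled as sets of points with distinct coordinates.\<close>

locale symbol_points =
  fixes qs :: "nat list" and P :: "'p set" and crd sym :: "'p \<Rightarrow> nat"
  assumes crd_less: "p \<in> P \<Longrightarrow> crd p < length qs"
    and sym_pos: "p \<in> P \<Longrightarrow> 0 < sym p"
    and sym_less: "p \<in> P \<Longrightarrow> sym p < qs ! crd p"
    and point_eqI: "\<lbrakk>p \<in> P; q \<in> P; crd p = crd q; sym p = sym q\<rbrakk> \<Longrightarrow> p = q"
    and point_exists: "\<lbrakk>i < length qs; 0 < s; s < qs ! i\<rbrakk> \<Longrightarrow> \<exists>p\<in>P. crd p = i \<and> sym p = s"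
begin

definition points :: "nat list \<Rightarrow> 'p set" where
  "points x = {p \<in> P. x ! crd p = sym p}"

lemma points_crd_eqI: "\<lbrakk>p \<in> points x; q \<in> points x; crd p = crd q\<rbrakk> \<Longrightarrow> p = q"
  unfolding points_def by (auto intro: point_eqI)

lemma point_at:
  assumes "x \<in> mixed_words qs" "i < length qs" "x ! i \<noteq> 0"
  obtains p where "p \<in> points x" "crd p = i"
proof -
  have "x ! i < qs ! i" using assms by (auto simp: mixed_words_def)
  then obtain p where "p \<in> P" "crd p = i" "sym p = x ! i"
    using point_exists[of i "x ! i"] assms by auto
  then show ?thesis using that[of p] by (auto simp: points_def)
qed

lemma support_eq_crd_image:
  assumes "x \<in> mixed_words qs"
  shows "{i. i < length x \<and> x ! i \<noteq> 0} = crd ` points x"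
proof -
  have len: "length x = length qs" using assms by (auto simp: mixed_words_def)
  show ?thesis
  proof (intro equalityI subsetI)
    fix i assume "i \<in> {i. i < length x \<and> x ! i \<noteq> 0}"
    then show "i \<in> crd ` points x" using point_at[OF assms, of i] len by auto
  next
    fix i assume "i \<in> crd ` points x"
    then show "i \<in> {i. i < length x \<and> x ! i \<noteq> 0}"
      using crd_less sym_pos len by (fastforce simp: points_def)
  qed
qed

lemma inj_on_crd_points: "inj_on crd (points x)"
  by (auto intro!: inj_onI points_crd_eqI)

lemma weight_eq_card_points: "x \<in> mixed_words qs \<Longrightarrow> weight x = card (points x)"
  unfolding weight_def support_eq_crd_image by (rule card_image[OF inj_on_crd_points])

lemma points_inject:
  assumes "x \<in> mixed_words qs" "y \<in> mixed_words qs" "points x = points y"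
  shows "x = y"
proof (rule nth_equalityI)
  show "length x = length y" using assms by (auto simp: mixed_words_def)
next
  fix i assume "i < length x"
  then have i: "i < length qs" using assms by (auto simp: mixed_words_def)
  show "x ! i = y ! i"
  proof (cases "x ! i = 0 \<and> y ! i = 0")
    case False
    then obtain p where "p \<in> points x" and p: "crd p = i"
      using point_at[OF assms(1) i] point_at[OF assms(2) i] assms(3) by metis
    then have "p \<in> points x" "p \<in> points y" using assms(3) by auto
    then show ?thesis using p by (auto simp: points_def)
  qed auto
qed

end

text \<open>Closure and cancellation are demanded only across different coordinates, since one word
  never has two points at the same coordinate. \<open>add_separates\<close> excludes two codewords
  on the same three coordinates that agree in exactly one of them, which would be at distance
  2.\<close>

locale partial_steiner_loop = symbol_points +
  fixes add :: "'a \<Rightarrow> 'a \<Rightarrow> 'a"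
  assumes alphabet: "q \<in> set qs \<Longrightarrow> 2 \<le> q"
    and add_closed: "\<lbrakk>u \<in> P; v \<in> P; crd u \<noteq> crd v\<rbrakk> \<Longrightarrow> add u v \<in> P"
    and crd_add: "\<lbrakk>u \<in> P; v \<in> P; crd u \<noteq> crd v\<rbrakk> \<Longrightarrow> crd (add u v) \<noteq> crd u"
    and add_commute: "\<lbrakk>u \<in> P; v \<in> P\<rbrakk> \<Longrightarrow> add u v = add v u"
    and add_add: "\<lbrakk>u \<in> P; v \<in> P; crd u \<noteq> crd v\<rbrakk> \<Longrightarrow> add u (add u v) = v"
    and add_separates: "\<lbrakk>v \<in> P; w \<in> P; v' \<in> P; w' \<in> P; crd v = crd v'; crd w = crd w';
      v \<noteq> v'; w \<noteq> w'; crd v \<noteq> crd w\<rbrakk> \<Longrightarrow> add v w \<noteq> add v' w'"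
begin

section \<open>Codewords as triples of points: covering and minimum distance\<close>

definition code :: "nat list set" where
  "code = {c \<in> mixed_words qs. \<exists>u\<in>P. \<exists>v\<in>P. crd u \<noteq> crd v \<and> points c = {u, v, add u v}}"

lemma crd_add': "\<lbrakk>u \<in> P; v \<in> P; crd u \<noteq> crd v\<rbrakk> \<Longrightarrow> crd (add u v) \<noteq> crd v"
  using crd_add[of v u] add_commute[of u v] by auto

lemma add_add': "\<lbrakk>u \<in> P; v \<in> P; crd u \<noteq> crd v\<rbrakk> \<Longrightarrow> add v (add u v) = u"
  using add_add[of v u] add_commute[of u v] by auto

lemma code_words: "c \<in> code \<Longrightarrow> c \<in> mixed_words qs"
  by (simp add: code_def)

lemma card_points_code: "c \<in> code \<Longrightarrow> card (points c) = 3"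
proof -
  assume "c \<in> code"
  then obtain u v where uv: "u \<in> P" "v \<in> P" "crd u \<noteq> crd v" "points c = {u, v, add u v}"
    by (auto simp: code_def)
  have "u \<noteq> v" "add u v \<noteq> u" "add u v \<noteq> v"
    using uv crd_add[of u v] crd_add'[of u v] by force+
  then show ?thesis using uv(4) by (simp add: eq_commute)
qed

text \<open>In \<open>{p, q, add p q}\<close> the sum of any two members is the third, so any two
  distinct points generate the codeword.\<close>

lemma points_code:
  assumes "c \<in> code" "u \<in> points c" "v \<in> points c" "u \<noteq> v"
  shows "points c = {u, v, add u v}"
proof -
  obtain p q where pq: "p \<in> P" "q \<in> P" "crd p \<noteq> crd q" and c: "points c = {p, q, add p q}"
    using assms(1) by (auto simp: code_def)
  have r: "add p q \<in> P" using pq add_closed by auto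
  have "add q p = add p q" "add p (add p q) = q" "add q (add p q) = p"
    "add (add p q) p = q" "add (add p q) q = p"
    using pq r add_commute add_add add_add' by metis+
  then show ?thesis using assms(2-4) unfolding c by auto
qed

lemma code_eqI:
  assumes "c \<in> code" "c' \<in> code" "u \<in> points c \<inter> points c'" "v \<in> points c \<inter> points c'" "u \<noteq> v"
  shows "c = c'"
  using points_inject[OF code_words code_words] points_code assms by (metis IntD1 IntD2)

text \<open>The heavier word \<open>c\<close> is nonzero somewhere that \<open>x\<close> is zero.
  That uses up the single coordinate of disagreement, so every nonzero entry of \<open>x\<close>
  survives in \<open>c\<close>.\<close>

lemma covered_points_subset:
  assumes x: "x \<in> mixed_words qs" and c: "c \<in> mixed_words qs"
    and "weight x < weight c" "covers c x"
  shows "points x \<subseteq> points c"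
proof
  let ?X = "{i. i < length x \<and> x ! i \<noteq> 0}" and ?C = "{i. i < length c \<and> c ! i \<noteq> 0}"
  have len: "length x = length c" "length c = length qs"
    using x c by (auto simp: mixed_words_def)
  obtain j where j: "{i. i < length x \<and> x ! i \<noteq> c ! i} = {j}"
    using assms(4) unfolding covers_def hamming_dist_def by (meson card_1_singletonE)
  have "\<not> ?C \<subseteq> ?X"
    using assms(3) card_mono[of ?X ?C] unfolding weight_def by auto
  then obtain i where "i < length x" "c ! i \<noteq> 0" "x ! i = 0" using len by auto
  moreover from this have "i \<in> {j}" unfolding j[symmetric] by simp
  ultimately have jx: "x ! j = 0" by simp
  fix u assume u: "u \<in> points x"
  then have "crd u < length x" "x ! crd u \<noteq> 0"
    using crd_less sym_pos len by (fastforce simp: points_def)+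
  moreover from this have "crd u \<notin> {j}" using jx by auto
  ultimately have "x ! crd u = c ! crd u" unfolding j[symmetric] by simp
  then show "u \<in> points c" using u by (auto simp: points_def)
qed

lemma ex1_cover:
  assumes x: "x \<in> mixed_words qs" and wt: "weight x = 2"
  shows "\<exists>!c. c \<in> code \<and> covers c x"
proof -
  obtain u v where uv: "points x = {u, v}" "u \<noteq> v"
    using wt weight_eq_card_points[OF x] by (metis card_2_iff)
  have P: "u \<in> P" "v \<in> P" using uv(1) by (auto simp: points_def)
  have crd: "crd u \<noteq> crd v" using uv points_crd_eqI[of u x v] by auto
  define w where "w = add u v"
  have w: "w \<in> P" "crd w \<noteq> crd u" "crd w \<noteq> crd v"
    using add_closed crd_add crd_add' P crd by (auto simp: w_def)
  have len: "length x = length qs" using x by (auto simp: mixed_words_def)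
  have wl: "crd w < length qs" using crd_less w by auto
  have x0: "x ! crd w = 0"
  proof (rule ccontr)
    assume "x ! crd w \<noteq> 0"
    then obtain p where "p \<in> points x" "crd p = crd w" using point_at[OF x wl] by metis
    then show False using uv w by auto
  qed
  \<comment> \<open>The third point is written into a coordinate where \<open>x\<close> has a zero,
    so both points of \<open>x\<close> are kept.\<close>
  define c where "c = x[crd w := sym w]"
  have cw: "c \<in> mixed_words qs"
    using x sym_less[OF w(1)] wl unfolding c_def mixed_words_def
    by (auto simp: nth_list_update)
  have "p \<in> points c \<longleftrightarrow> p = w \<or> p \<in> points x" for p
  proof (cases "crd p = crd w")
    case True
    then show ?thesis using w(1) wl len x0 point_eqI[of p w] sym_pos[of p]
      by (auto simp: points_def c_def)
  next
    case False
    then show ?thesis by (auto simp: points_def c_def)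
  qed
  then have pc: "points c = {u, v, w}" using uv by auto
  have cc: "c \<in> code" unfolding code_def using cw P crd pc w_def by blast
  have "{i. i < length x \<and> x ! i \<noteq> c ! i} = {crd w}"
    using x0 sym_pos[OF w(1)] wl len by (auto simp: c_def nth_list_update)
  then have cov: "covers c x" by (simp add: covers_def hamming_dist_def)
  show ?thesis
  proof (rule ex1I)
    show "c \<in> code \<and> covers c x" using cc cov by simp
  next
    fix c' assume c': "c' \<in> code \<and> covers c' x"
    then have "weight c' = 3"
      using weight_eq_card_points code_words card_points_code by metis
    then have "points x \<subseteq> points c'"
      using covered_points_subset[OF x] c' code_words wt by auto
    then show "c' = c" using code_eqI[of c' c u v] c' cc pc uv by auto
  qed
qed

text \<open>Distance at most 2 and at most one common point must together account for three support
  coordinates, so both bounds are attained and the supports coincide. The common point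
  \<open>u\<close> is then the sum of the other two points in either word, against
  \<open>add_separates\<close>.\<close>

lemma hamming_dist_code:
  assumes c: "c \<in> code" and c': "c' \<in> code" and neq: "c \<noteq> c'"
  shows "3 \<le> hamming_dist c c'"
proof (rule ccontr)
  define D where "D = {i. i < length c \<and> c ! i \<noteq> c' ! i}"
  define I where "I = points c \<inter> points c'"
  assume "\<not> 3 \<le> hamming_dist c c'"
  then have D2: "card D \<le> 2" by (simp add: hamming_dist_def D_def)
  have finD: "finite D" by (simp add: D_def)
  have len: "length c = length qs" "length c' = length qs"
    using code_words c c' by (auto simp: mixed_words_def)
  have card3: "card (points c) = 3" "card (points c') = 3" using card_points_code c c' by auto
  then have fin: "finite (points c)" "finite (points c')" by (auto intro: card_ge_0_finite)
  have finI: "finite I" using fin by (simp add: I_def)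
  have I1: "card I \<le> 1"
  proof (rule ccontr)
    assume "\<not> card I \<le> 1"
    then obtain u v where "u \<in> I" "v \<in> I" "u \<noteq> v"
      using card_le_Suc0_iff_eq[OF finI] by auto
    then show False using code_eqI[OF c c'] neq by (auto simp: I_def)
  qed
  \<comment> \<open>Outside \<open>D\<close> the words agree, so a point of one at such a coordinate
    is a point of both.\<close>
  have sub: "crd ` points c \<subseteq> D \<union> crd ` I" "crd ` points c' \<subseteq> D \<union> crd ` I"
    using crd_less len by (auto simp: D_def I_def points_def image_iff)
  have cardc: "card (crd ` points c) = 3" "card (crd ` points c') = 3"
    using card3 by (simp_all add: card_image inj_on_crd_points)
  have "card (D \<union> crd ` I) \<le> card D + card (crd ` I)" by (rule card_Un_le)
  moreover have cI: "card (crd ` I) \<le> card I" using finI by (rule card_image_le)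
  moreover have "3 \<le> card (D \<union> crd ` I)"
    using card_mono[OF _ sub(1)] cardc finD finI by auto
  ultimately have cardDI: "card (D \<union> crd ` I) = 3" and cardI: "card I = 1"
    using D2 I1 by linarith+
  have supp: "crd ` points c = D \<union> crd ` I" "crd ` points c' = D \<union> crd ` I"
    using card_subset_eq[OF _ sub(1)] card_subset_eq[OF _ sub(2)] cardDI cardc finD finI by auto
  obtain u where I: "I = {u}" using cardI by (rule card_1_singletonE)
  then have u: "u \<in> points c" "u \<in> points c'" by (auto simp: I_def)
  have "points c \<noteq> {u}" using card3 by auto
  then obtain v where v: "v \<in> points c" "v \<noteq> u" using u by auto
  define w where "w = add u v"
  have pc: "points c = {u, v, w}" using points_code[OF c u(1) v(1)] v w_def by auto
  then have dist: "w \<noteq> u" "w \<noteq> v" using card3(1) v by (auto simp: card_insert_if split: if_splits)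
  have w: "w \<in> points c" using pc by simp
  obtain v' where v': "v' \<in> points c'" "crd v' = crd v"
    using supp v by (metis imageE imageI)
  obtain w' where w': "w' \<in> points c'" "crd w' = crd w"
    using supp w by (metis imageE imageI)
  have P: "u \<in> P" "v \<in> P" "w \<in> P" "v' \<in> P" "w' \<in> P"
    using u v v' w w' by (auto simp: points_def)
  have "v \<notin> I" "w \<notin> I" using I v dist by auto
  then have nn: "v \<noteq> v'" "w \<noteq> w'" using v v' w w' by (auto simp: I_def)
  have crds: "crd v \<noteq> crd w" "crd v \<noteq> crd u" "crd w \<noteq> crd u"
    using points_crd_eqI u(1) v w dist by metis+
  have "points c = {v, w, add v w}" "points c' = {v', w', add v' w'}"
    using points_code[OF c v(1) w] dist points_code[OF c' v'(1) w'(1)] v' w' crds by metis+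
  then have "u = add v w" "u = add v' w'" using u v dist v' w' crds by auto
  then show False using add_separates[of v w v' w'] P nn v' w' crds by auto
qed

theorem mixed_steiner_triple_system_code: "mixed_steiner_triple_system qs code"
  unfolding mixed_steiner_triple_system_def
proof (intro conjI ballI impI subsetI)
  show "weight c = 3" if "c \<in> code" for c
    using that by (simp add: weight_eq_card_points code_words card_points_code)
qed (simp_all add: alphabet code_words ex1_cover hamming_dist_code)

end

section \<open>Steiner loops from the constructions of Bose and Skolem\<close>

locale steiner_loop =
  fixes m :: nat and f :: "nat \<Rightarrow> nat \<Rightarrow> nat"
  assumes closed: "\<lbrakk>x \<le> m; y \<le> m\<rbrakk> \<Longrightarrow> f x y \<le> m"
    and commute: "\<lbrakk>x \<le> m; y \<le> m\<rbrakk> \<Longrightarrow> f x y = f y x"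
    and zero: "x \<le> m \<Longrightarrow> f x 0 = x"
    and self: "x \<le> m \<Longrightarrow> f x x = 0"
    and cancel: "\<lbrakk>x \<le> m; y \<le> m\<rbrakk> \<Longrightarrow> f x (f x y) = y"

locale steiner_quasigroup =
  fixes S :: "'a set" and op :: "'a \<Rightarrow> 'a \<Rightarrow> 'a"
  assumes closed: "\<lbrakk>x \<in> S; y \<in> S\<rbrakk> \<Longrightarrow> op x y \<in> S"
    and commute: "\<lbrakk>x \<in> S; y \<in> S\<rbrakk> \<Longrightarrow> op x y = op y x"
    and idem: "x \<in> S \<Longrightarrow> op x x = x"
    and cancel: "\<lbrakk>x \<in> S; y \<in> S\<rbrakk> \<Longrightarrow> op x (op x y) = y"

text \<open>The elements are numbered from 1, which frees 0 to be the identity; the rule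
  \<open>op x x = x\<close> is replaced by \<open>f x x = 0\<close>.\<close>

lemma (in steiner_quasigroup) ex_steiner_loop:
  assumes "finite S" "card S = m"
  shows "\<exists>f. steiner_loop m f"
proof -
  obtain h where h: "bij_betw h {1..m} S"
    using assms finite_same_card_bij[of "{1..m}" S] by auto
  define g where "g = inv_into {1..m} h"
  have hS: "h x \<in> S" if "0 < x" "x \<le> m" for x
    using h that by (auto simp: bij_betw_def)
  have gh: "g (h x) = x" if "0 < x" "x \<le> m" for x
    using h that by (auto simp: g_def bij_betw_def inv_into_f_f)
  have hg: "h (g y) = y" if "y \<in> S" for y
    using h that by (auto simp: g_def bij_betw_def f_inv_into_f)
  have gS: "0 < g y \<and> g y \<le> m" if "y \<in> S" for y
    using h that inv_into_into[of y h "{1..m}"] by (auto simp: g_def bij_betw_def)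
  have op_neq: "op x y \<noteq> x" if "x \<in> S" "y \<in> S" "x \<noteq> y" for x y
    using that cancel[of x y] idem[of x] by auto
  define f where "f x y = (if x = 0 then y else if y = 0 then x else if x = y then 0
    else g (op (h x) (h y)))" for x y
  have "steiner_loop m f"
  proof
    fix x y assume "x \<le> m" "y \<le> m"
    then show "f x y \<le> m" using gS closed hS by (auto simp: f_def)
    show "f x y = f y x" using \<open>x \<le> m\<close> \<open>y \<le> m\<close> commute hS by (auto simp: f_def)
    show "f x (f x y) = y"
    proof (cases "x = 0 \<or> y = 0 \<or> x = y")
      case False
      let ?z = "op (h x) (h y)"
      have S: "h x \<in> S" "h y \<in> S" using False hS \<open>x \<le> m\<close> \<open>y \<le> m\<close> by auto
      have "h x \<noteq> h y" using gh[of x] gh[of y] False \<open>x \<le> m\<close> \<open>y \<le> m\<close> by auto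
      then have "?z \<noteq> h x" using op_neq S by auto
      then have "x \<noteq> g ?z" using hg[OF closed[OF S]] by auto
      then show ?thesis
        using False gS[OF closed[OF S]] hg[OF closed[OF S]] cancel[OF S] gh \<open>y \<le> m\<close>
        by (auto simp: f_def)
    qed (auto simp: f_def)
  qed (auto simp: f_def)
  then show ?thesis by blast
qed

text \<open>
  A commutative quasigroup on \<open>{0, \<dots>, n - 1}\<close> with left division \<open>ld\<close>. The case \<open>n = t\<close>, where
  \<open>mul\<close> is idempotent, is Bose's; the case \<open>n = 2t\<close>, where \<open>mul\<close> is half-idempotent, is Skolem's.
\<close>
locale bose_skolem =
  fixes n t :: nat and mul ld :: "nat \<Rightarrow> nat \<Rightarrow> nat"
  assumes n_cases: "n = t \<or> n = 2 * t"
    and mul_less: "\<lbrakk>x < n; y < n\<rbrakk> \<Longrightarrow> mul x y < n"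
    and ld_less: "\<lbrakk>x < n; y < n\<rbrakk> \<Longrightarrow> ld x y < n"
    and mul_commute: "\<lbrakk>x < n; y < n\<rbrakk> \<Longrightarrow> mul x y = mul y x"
    and mul_ld: "\<lbrakk>x < n; y < n\<rbrakk> \<Longrightarrow> mul x (ld x y) = y"
    and ld_mul: "\<lbrakk>x < n; y < n\<rbrakk> \<Longrightarrow> ld x (mul x y) = y"
    and mul_self: "x < n \<Longrightarrow> mul x x = x mod t"
begin

text \<open>\<open>None\<close> is the point at infinity of Skolem's construction.\<close>
definition carrier :: "(nat \<times> nat) option set" where
  "carrier = Some ` ({..<n} \<times> {..<3}) \<union> (if n = 2 * t then {None} else {})"

definition next_level :: "nat \<Rightarrow> nat" where "next_level i = (if i = 2 then 0 else Suc i)"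
definition prev_level :: "nat \<Rightarrow> nat" where "prev_level i = (if i = 0 then 2 else i - 1)"

text \<open>The third point of the block through \<open>(x, i)\<close> and \<open>(y, i + 1)\<close>.\<close>
definition up :: "nat \<Rightarrow> nat \<Rightarrow> nat \<Rightarrow> (nat \<times> nat) option" where
  "up x i y = (if ld x y \<noteq> x then Some (ld x y, i)
     else if x = y then Some (x, prev_level i) else None)"

text \<open>The blocks through infinity are
  \<open>{None, Some (x + t, i), Some (x, next_level i)}\<close> with \<open>x < t\<close>.\<close>

definition infinity :: "nat \<Rightarrow> nat \<Rightarrow> (nat \<times> nat) option" where
  "infinity x i = (if x < t then Some (x + t, prev_level i) else Some (x - t, next_level i))"

text \<open>Besides the blocks through infinity there are
  \<open>{(x, i), (y, i), (mul x y, next_level i)}\<close> for \<open>x \<noteq> y\<close> and the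
  vertical blocks \<open>{(x, 0), (x, 1), (x, 2)}\<close> for \<open>x < t\<close>.\<close>

fun third :: "(nat \<times> nat) option \<Rightarrow> (nat \<times> nat) option \<Rightarrow> (nat \<times> nat) option" where
  "third None None = None"
| "third None (Some (x, i)) = infinity x i"
| "third (Some (x, i)) None = infinity x i"
| "third (Some (x, i)) (Some (y, j)) =
     (if i = j then if x = y then Some (x, i) else Some (mul x y, next_level i)
      else if j = next_level i then up x i y else up y j x)"

section \<open>The blocks form a Steiner quasigroup\<close>

lemma ld_eq_iff: "\<lbrakk>x < n; y < n; z < n\<rbrakk> \<Longrightarrow> ld x y = z \<longleftrightarrow> mul x z = y"
  using mul_ld ld_mul by metis

text \<open>This is the degenerate case of \<open>up\<close>, where the generic rule would return
  \<open>(x, i)\<close> itself. The block is then vertical if \<open>x < t\<close> and passes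
  through infinity otherwise.\<close>

lemma ld_self_iff: "\<lbrakk>x < n; y < n\<rbrakk> \<Longrightarrow> ld x y = x \<longleftrightarrow> y = x mod t"
  using ld_eq_iff[of x y x] mul_self by auto

lemma mod_t: "x < n \<Longrightarrow> x mod t = (if x < t then x else x - t)"
  using n_cases mod_if[of x t] mod_if[of "x - t" t] by auto

lemma level_cases: "i < 3 \<Longrightarrow> i = 0 \<or> i = 1 \<or> i = (2::nat)"
  by auto

lemma carrier_simps:
  "Some (x, i) \<in> carrier \<longleftrightarrow> x < n \<and> i < 3" "None \<in> carrier \<longleftrightarrow> n = 2 * t"
  by (auto simp: carrier_def)

lemma up_carrier: "\<lbrakk>x < n; y < n; i < 3\<rbrakk> \<Longrightarrow> up x i y \<in> carrier"
  using n_cases by (auto simp: up_def carrier_simps ld_less ld_self_iff prev_level_def)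

lemma infinity_carrier:
  assumes "Some (x, i) \<in> carrier" "None \<in> carrier"
  shows "infinity x i \<in> carrier"
  using assms
  by (auto simp: infinity_def carrier_def prev_level_def next_level_def image_iff split: if_splits)

lemma third_carrier:
  assumes "p \<in> carrier" "q \<in> carrier"
  shows "third p q \<in> carrier"
  using assms
  by (cases "(p, q)" rule: third.cases)
    (auto simp: infinity_carrier, auto simp: carrier_simps up_carrier next_level_def mul_less)

lemma third_commute:
  assumes "p \<in> carrier" "q \<in> carrier"
  shows "third p q = third q p"
  using assms
  by (cases "(p, q)" rule: third.cases)
    (auto simp: carrier_simps mul_commute next_level_def split: if_splits)

text \<open>The case split runs through the three kinds of block: generic, vertical, and through
  infinity.\<close>

lemma up_cancel:
  assumes "x < n" "y < n" "i < 3"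
  shows "third (Some (x, i)) (up x i y) = Some (y, next_level i)"
    and "third (Some (y, next_level i)) (up x i y) = Some (x, i)"
proof -
  let ?j = "next_level i" and ?h = "prev_level i"
  \<comment> \<open>The levels form a 3-cycle, so two steps forward are one step back.\<close>
  have levels: "?j \<noteq> i" "?h \<noteq> i" "?h \<noteq> ?j" "next_level ?j = ?h" "next_level ?h = i"
    "prev_level ?h = ?j" "prev_level ?j = i"
    using level_cases[OF assms(3)] by (auto simp: next_level_def prev_level_def)
  note levels(1-3)[symmetric, simp] levels[simp]
  have "third (Some (x, i)) (up x i y) = Some (y, ?j) \<and>
    third (Some (y, ?j)) (up x i y) = Some (x, i)"
  proof (cases "ld x y = x")
    case False
    have "ld x y < n" "mul x (ld x y) = y" using assms by (auto simp: ld_less mul_ld)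
    moreover from this have "ld (ld x y) y = x"
      using ld_eq_iff[of "ld x y" y x] mul_commute[of x "ld x y"] assms by auto
    ultimately show ?thesis using False by (auto simp: up_def)
  next
    case True
    then have y: "y = x mod t" using ld_self_iff assms by auto
    show ?thesis
    proof (cases "y = x")
      case True
      then show ?thesis using \<open>ld x y = x\<close> by (simp add: up_def)
    next
      case False
      then have "\<not> x < t" "y = x - t" "y < t"
        using y mod_t[of x] assms n_cases by (auto split: if_splits)
      then show ?thesis using False True by (simp add: up_def infinity_def)
    qed
  qed
  then show "third (Some (x, i)) (up x i y) = Some (y, ?j)"
    "third (Some (y, ?j)) (up x i y) = Some (x, i)" by auto
qed

lemma third_cancel:
  assumes "p \<in> carrier" "q \<in> carrier"
  shows "third p (third p q) = q"
proof (cases "(p, q)" rule: third.cases)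
  case 1
  then show ?thesis by simp
next
  case (2 x i)
  then have "x < n" "n = 2 * t" "i < 3" using assms carrier_simps(1)[of x i] carrier_simps(2)
    by simp_all
  then show ?thesis using 2 level_cases[OF \<open>i < 3\<close>]
    by (auto simp: infinity_def next_level_def prev_level_def)
next
  case (3 x i)
  then have "x < n" "n = 2 * t" "i < 3" using assms carrier_simps(1)[of x i] carrier_simps(2)
    by simp_all
  show ?thesis
  proof (cases "x < t")
    case True
    \<comment> \<open>Since \<open>mul (x + t) (x + t) = x\<close>, the rule \<open>up\<close>
      reaches its last branch and returns \<open>None\<close>.\<close>
    then have "ld (x + t) x = x + t"
      using ld_self_iff[of "x + t" x] \<open>n = 2 * t\<close> by auto
    then show ?thesis using True 3 level_cases[OF \<open>i < 3\<close>]
      by (auto simp: infinity_def up_def next_level_def prev_level_def)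
  next
    case False
    then have "ld x (x - t) = x" "x - t \<noteq> x"
      using ld_self_iff[of x "x - t"] mod_t[of x] \<open>x < n\<close> \<open>n = 2 * t\<close> by auto
    then show ?thesis using False 3 level_cases[OF \<open>i < 3\<close>]
      by (auto simp: infinity_def up_def next_level_def prev_level_def)
  qed
next
  case (4 x i y j)
  then have xy: "x < n" "y < n" "i < 3" "j < 3" using assms by (auto simp: carrier_simps)
  have next_neq: "next_level i \<noteq> i" "next_level j \<noteq> j" by (auto simp: next_level_def)
  \<comment> \<open>Of two distinct levels in a 3-cycle, one always follows the other.\<close>
  consider "i = j" | "j = next_level i" | "i \<noteq> j" "j \<noteq> next_level i" "i = next_level j"
    using level_cases[OF xy(3)] level_cases[OF xy(4)] by (fastforce simp: next_level_def)
  then show ?thesis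
  proof cases
    case 1
    then show ?thesis using 4 xy ld_mul[of x y] next_neq by (auto simp: up_def)
  next
    case 2
    then show ?thesis using 4 xy up_cancel(1)[of x y i] next_neq by auto
  next
    case 3
    then show ?thesis using 4 xy up_cancel(2)[of y x j] next_neq by auto
  qed
qed

lemma steiner_quasigroup_third: "steiner_quasigroup carrier third"
proof
  fix p assume "p \<in> carrier"
  then show "third p p = p" by (cases p) auto
qed (simp_all add: third_carrier third_commute third_cancel)

lemma card_carrier: "finite carrier" "card carrier = (if n = 2 * t then 3 * n + 1 else 3 * n)"
  by (auto simp: carrier_def card_image card_cartesian_product card_insert_if)

end

text \<open>Addition modulo \<open>n\<close> is a commutative quasigroup, and relabelling its values
  by a permutation keeps it one. The permutation is chosen to give the required diagonal; division
  undoes it and then subtracts \<open>x\<close>.\<close>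

lemma ex_bose_skolem:
  assumes "n = t \<and> odd n \<or> n = 2 * t"
  shows "\<exists>mul ld. bose_skolem n t mul ld"
proof -
  \<comment> \<open>Halving is a permutation of \<open>{0, \<dots>, n - 1}\<close> that sends \<open>2x mod n\<close> to \<open>x mod t\<close>.\<close>
  define half where "half z = (if even z then z div 2 else (z + n) div 2)" for z
  \<comment> \<open>For even \<open>n\<close> and odd \<open>z\<close>, \<open>div\<close> rounds
    \<open>(z + n) div 2\<close> down; the summand 1 in the last branch restores this.\<close>
  define double where "double w = (if 2 * w < n then 2 * w
    else if odd n then 2 * w - n else 2 * w + 1 - n)" for w
  have half: "half z < n" "double (half z) = z" if "z < n" for z
    using that by (auto simp: half_def double_def elim!: evenE oddE)
  have double: "double w < n" "half (double w) = w" if "w < n" for w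
    using that by (auto simp: half_def double_def elim!: evenE oddE)
  have half_twice: "half ((x + x) mod n) = x mod t" if "x < n" for x
  proof (cases "x + x < n")
    case True
    then have "x < t" using assms by auto
    then show ?thesis using True by (simp add: half_def)
  next
    case False
    then have twice: "(x + x) mod n = x + x - n" using that by (simp add: mod_if)
    \<comment> \<open>After wrapping, \<open>2x - n\<close> is even for \<open>n = 2t\<close> and
      halves to \<open>x - t\<close>; for odd \<open>n\<close> it is odd, so \<open>half\<close>
      adds \<open>n\<close> back and yields \<open>x\<close>.\<close>
    show ?thesis
    proof (cases "n = 2 * t")
      case True
      then have "x mod t = x - t" "x + x - n = 2 * (x - t)"
        using False that by (auto simp: mod_if)
      then show ?thesis unfolding twice by (simp add: half_def)
    next
      case odd: False
      then have "n = t" "odd (x + x - n)" using assms False by auto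
      then show ?thesis unfolding twice using False that by (simp add: half_def)
    qed
  qed
  define mul where "mul x y = half ((x + y) mod n)" for x y
  define ld where "ld x y = (double y + (n - x)) mod n" for x y
  have "bose_skolem n t mul ld"
  proof
    show "n = t \<or> n = 2 * t" using assms by auto
  next
    fix x y assume xy: "x < n" "y < n"
    then show "mul x y < n" "ld x y < n" by (auto simp: mul_def ld_def half)
    show "mul x y = mul y x" by (simp add: mul_def add.commute)
    have "(x + (double y + (n - x)) mod n) mod n = (double y + n) mod n"
      using xy by (simp add: mod_simps)
    then show "mul x (ld x y) = y" using xy double[of y] by (simp add: mul_def ld_def)
    have "((x + y) mod n + (n - x)) mod n = (y + n) mod n"
      using xy by (simp only: mod_add_left_eq) simp
    then show "ld x (mul x y) = y"
      using xy half(2)[of "(x + y) mod n"] by (simp add: mul_def ld_def)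
  next
    fix x assume "x < n"
    then show "mul x x = x mod t" using half_twice by (simp add: mul_def)
  qed
  then show ?thesis by blast
qed

section \<open>Steiner loops for both residue classes\<close>

theorem ex_steiner_loop:
  assumes "m mod 6 = 1 \<or> m mod 6 = 3"
  shows "\<exists>f. steiner_loop m f"
proof -
  define q where "q = m div 6"
  have "m = 6 * q + 1 \<or> m = 6 * q + 3"
    using assms div_mult_mod_eq[of m 6] unfolding q_def by linarith
  then obtain n t where "n = t \<and> odd n \<or> n = 2 * t"
    and m: "(if n = 2 * t then 3 * n + 1 else 3 * n) = m"
  proof
    assume "m = 6 * q + 1"
    \<comment> \<open>Skolem's case; for \<open>q = 0\<close> the carrier is just
      \<open>{None}\<close>, the system with one point.\<close>
    then show thesis using that[of "2 * q" q] by simp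
  next
    assume "m = 6 * q + 3"
    \<comment> \<open>Bose's case, with three levels of odd size.\<close>
    then show thesis using that[of "2 * q + 1" "2 * q + 1"] by simp
  qed
  then obtain mul ld where "bose_skolem n t mul ld" using ex_bose_skolem by blast
  then interpret bose_skolem n t mul ld .
  interpret steiner_quasigroup carrier third by (rule steiner_quasigroup_third)
  have "card carrier = m" using m by (simp only: card_carrier)
  then show ?thesis using ex_steiner_loop card_carrier(1) by blast
qed

context steiner_loop
begin

lemma zero_left: "x \<le> m \<Longrightarrow> f 0 x = x"
  using zero commute[of 0 x] by simp

lemma eq_zero_iff: "\<lbrakk>x \<le> m; y \<le> m\<rbrakk> \<Longrightarrow> f x y = 0 \<longleftrightarrow> x = y"
  using cancel[of x y] zero self by auto

lemma eq_left_iff: "\<lbrakk>x \<le> m; y \<le> m\<rbrakk> \<Longrightarrow> f x y = x \<longleftrightarrow> y = 0"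
  using cancel[of x y] zero self by auto

end

section \<open>The product of two Steiner loops\<close>

locale two_steiner_loops =
  F: steiner_loop k f + G: steiner_loop l g for k l f g +
  assumes k_pos: "0 < k" and l_pos: "0 < l"
begin

definition alphabets :: "nat list" where
  "alphabets = replicate (k * l) 2 @ [k + 1, l + 1]"

definition nonzero :: "(nat \<times> nat) set" where
  "nonzero = {..k} \<times> {..l} - {(0, 0)}"

fun crd :: "nat \<times> nat \<Rightarrow> nat" where
  "crd (a, b) = (if b = 0 then k * l else if a = 0 then k * l + 1 else (a - 1) * l + (b - 1))"

text \<open>When one entry is zero, \<open>a + b\<close> is simply the other entry.\<close>

fun sym :: "nat \<times> nat \<Rightarrow> nat" where
  "sym (a, b) = (if a = 0 \<or> b = 0 then a + b else 1)"

fun add :: "nat \<times> nat \<Rightarrow> nat \<times> nat \<Rightarrow> nat \<times> nat" where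
  "add (a, b) (a', b') = (f a a', g b b')"

lemma grid_less:
  assumes "0 < a" "a \<le> k" "0 < b" "b \<le> l"
  shows "(a - 1) * l + (b - 1) < k * l"
proof -
  have "(a - 1) * l + (b - 1) < (a - 1) * l + l" using assms by simp
  also have "\<dots> = a * l" using assms by (cases a) auto
  also have "\<dots> \<le> k * l" using assms by simp
  finally show ?thesis .
qed

lemma grid_eq:
  assumes "0 < a" "0 < b" "b \<le> l" "0 < a'" "0 < b'" "b' \<le> l"
    and "(a - 1) * l + (b - 1) = (a' - 1) * l + (b' - 1)"
  shows "a = a' \<and> b = b'"
proof -
  have digits: "(q * l + r) div l = q \<and> (q * l + r) mod l = r" if "r < l" for q r
    using that by simp
  have "b - 1 < l" "b' - 1 < l" using assms by linarith+
  then have "a - 1 = a' - 1" "b - 1 = b' - 1" using digits assms(7) by metis+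
  then show ?thesis using assms by linarith
qed

text \<open>Row-major numbering is injective on the binary coordinates, so distinct points can share
  only one of the two large coordinates.\<close>

lemma crd_eq_iff:
  assumes "(a, b) \<in> nonzero" "(a', b') \<in> nonzero"
  shows "crd (a, b) = crd (a', b') \<longleftrightarrow>
    (a = a' \<and> b = b') \<or> (b = 0 \<and> b' = 0) \<or> (a = 0 \<and> a' = 0)"
  using assms grid_less[of a b] grid_less[of a' b'] grid_eq[of a b a' b']
  by (auto simp: nonzero_def simp del: One_nat_def)

lemma symbol_points: "symbol_points alphabets nonzero crd sym"
proof
  fix p assume p: "p \<in> nonzero"
  obtain a b where ab: "p = (a, b)" by (cases p)
  show "crd p < length alphabets" "0 < sym p" "sym p < alphabets ! crd p"
    using p grid_less[of a b] unfolding ab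
    by (auto simp: nonzero_def alphabets_def nth_append simp del: One_nat_def)
next
  fix p q assume "p \<in> nonzero" "q \<in> nonzero" "crd p = crd q" "sym p = sym q"
  then show "p = q"
    using crd_eq_iff by (cases p; cases q) (auto simp: nonzero_def simp del: crd.simps split: if_splits)
next
  fix i s assume i: "i < length alphabets" and s: "0 < s" "s < alphabets ! i"
  consider "i < k * l" | "i = k * l" | "i = k * l + 1"
    using i by (force simp: alphabets_def less_Suc_eq)
  then show "\<exists>p\<in>nonzero. crd p = i \<and> sym p = s"
  proof cases
    case 1
    then have "s = 1" using s by (auto simp: alphabets_def nth_append)
    moreover have "i div l < k" "i mod l < l"
      using 1 l_pos by (auto simp: less_mult_imp_div_less)
    ultimately show ?thesis
      by (intro bexI[of _ "(i div l + 1, i mod l + 1)"]) (auto simp: nonzero_def)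
  next
    case 2
    then show ?thesis using s
      by (intro bexI[of _ "(s, 0)"]) (auto simp: nonzero_def alphabets_def nth_append)
  next
    case 3
    then show ?thesis using s
      by (intro bexI[of _ "(0, s)"]) (auto simp: nonzero_def alphabets_def nth_append)
  qed
qed

text \<open>Every element of the product is its own only inverse.\<close>

lemma add_nonzero:
  assumes "u \<in> nonzero" "v \<in> nonzero" "u \<noteq> v"
  shows "add u v \<in> nonzero"
  using assms by (cases u; cases v)
    (auto simp: nonzero_def F.closed G.closed F.eq_zero_iff G.eq_zero_iff)

lemma partial_steiner_loop: "partial_steiner_loop alphabets nonzero crd sym add"
proof -
  interpret symbol_points alphabets nonzero crd sym by (rule symbol_points)
  show ?thesis
  proof
    fix q assume "q \<in> set alphabets"
    then show "2 \<le> q" using k_pos l_pos by (auto simp: alphabets_def)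
  next
    fix u v assume uv: "u \<in> nonzero" "v \<in> nonzero"
    obtain a b a' b' where p: "u = (a, b)" "v = (a', b')" by (cases u; cases v)
    have le: "a \<le> k" "a' \<le> k" "b \<le> l" "b' \<le> l" using uv p by (auto simp: nonzero_def)
    show "add u v = add v u" using le F.commute G.commute by (auto simp: p)
    assume crd: "crd u \<noteq> crd v"
    show closed: "add u v \<in> nonzero" using add_nonzero[OF uv] crd by metis
    show "add u (add u v) = v" using le F.cancel G.cancel by (auto simp: p)
    \<comment> \<open>If the sum equalled \<open>u\<close>, then \<open>v\<close> would be zero; if
      both lay in one large coordinate, so would \<open>v\<close>.\<close>
    show "crd (add u v) \<noteq> crd u"
      using crd closed uv le unfolding p
      by (auto simp: crd_eq_iff F.eq_left_iff G.eq_left_iff F.zero_left G.zero_left nonzero_def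
          simp del: crd.simps)
  next
    fix v w v' w'
    assume P: "v \<in> nonzero" "w \<in> nonzero" "v' \<in> nonzero" "w' \<in> nonzero"
      and crd: "crd v = crd v'" "crd w = crd w'" "v \<noteq> v'" "w \<noteq> w'" "crd v \<noteq> crd w"
    \<comment> \<open>Distinct points sharing a coordinate lie in a large one, so \<open>v\<close>,
      \<open>v'\<close> belong to one factor and \<open>w\<close>, \<open>w'\<close> to the other.
      The sum then displays both summands as its entries.\<close>
    then show "add v w \<noteq> add v' w'"
      by (cases v; cases w; cases v'; cases w')
        (auto simp: crd_eq_iff F.zero G.zero F.zero_left G.zero_left simp del: crd.simps,
          auto simp: nonzero_def F.zero G.zero F.zero_left G.zero_left)
  qed
qed

end

theorem corollary2:
  fixes k l n :: nat
  assumes "0 < k" and "0 < l"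
    and "k mod 6 = 1 \<or> k mod 6 = 3"
    and "l mod 6 = 1 \<or> l mod 6 = 3"
    and "n = k * l"
  shows "\<exists>C. mixed_steiner_triple_system (replicate n 2 @ [k + 1, l + 1]) C"
proof -
  obtain f g where "steiner_loop k f" "steiner_loop l g"
    using ex_steiner_loop assms(3,4) by blast
  then interpret two_steiner_loops k l f g
    using assms(1,2) by (simp add: two_steiner_loops_def two_steiner_loops_axioms_def)
  interpret partial_steiner_loop alphabets nonzero crd sym add
    by (rule partial_steiner_loop)
  show ?thesis
    using mixed_steiner_triple_system_code unfolding alphabets_def assms(5) by blast
qed

end
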